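(* Let $f:\mathbb{R}\to\mathbb{R}$ be a vertically rigid function. (i) Suppose that there are $a,b\in\mathbb{R}$ with $b\neq 0$ such that $f(x)=a+bx$ for Lebesgue almost every $x\in\mathbb{R}$, or such that $f(x)=a+bx$ for all $x$ in a comeagre subset of $\mathbb{R}$. Then $f(x)=a+bx$ for every $x\in\mathbb{R}$. (ii) Suppose that there are $a,b,k\in\mathbb{R}$ with $bk\neq 0$ such that $f(x)=a+be^{kx}$ for Lebesgue almost every $x\in\mathbb{R}$, or such that $f(x)=a+be^{kx}$ for all $x$ in a comeagre subset of $\mathbb{R}$. Then $f(x)=a+be^{kx}$ for every $x\in\mathbb{R}$.
   Context: For a function $h:\mathbb{R}\to\mathbb{R}$, $\mathrm{graph}(h)=\{(x,h(x)):x\in\mathbb{R}\}\subset\mathbb{R}^2$. A function $f:\mathbb{R}\to\mathbb{R}$ is called vertically rigid if for every $c\in(0,\infty)$ there exists an isometry $\varphi$ of the Euclidean plane $\mathbb{R}^2$ with $\varphi(\mathrm{graph}(cf))=\mathrm{graph}(f)$. A set is comeagre if its complement is meagre (first category). *)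

theory Defs
  imports "HOL-Analysis.Analysis"
begin

definition graph_of :: "(real \<Rightarrow> real) \<Rightarrow> (real \<times> real) set" where
  "graph_of h = {(x, h x) |x. x \<in> UNIV}"

text \<open>
  The metric of the product type \<^typ>\<open>real \<times> real\<close> is the Euclidean one. Surjectivity is not
  demanded, since every distance-preserving map of the Euclidean plane into itself is onto.
\<close>

definition plane_isometry :: "(real \<times> real \<Rightarrow> real \<times> real) \<Rightarrow> bool" where
  "plane_isometry \<phi> \<longleftrightarrow> (\<forall>p q. dist (\<phi> p) (\<phi> q) = dist p q)"

definition vertically_rigid :: "(real \<Rightarrow> real) \<Rightarrow> bool" where
  "vertically_rigid f \<longleftrightarrow>
     (\<forall>c>0. \<exists>\<phi>. plane_isometry \<phi> \<and> \<phi> ` graph_of (\<lambda>x. c * f x) = graph_of f)"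

definition nowhere_dense :: "'a::topological_space set \<Rightarrow> bool" where
  "nowhere_dense S \<longleftrightarrow> interior (closure S) = {}"

definition meagre :: "'a::topological_space set \<Rightarrow> bool" where
  "meagre S \<longleftrightarrow> (\<exists>N :: nat \<Rightarrow> 'a set. (\<forall>n. nowhere_dense (N n)) \<and> S = (\<Union>n. N n))"

definition comeagre :: "'a::topological_space set \<Rightarrow> bool" where
  "comeagre S \<longleftrightarrow> meagre (- S)"

end

theory Submission
  imports Defs "HOL-Real_Asymp.Real_Asymp"
begin

text \<open>
  Let \<open>E\<close> be the exceptional set where \<open>f\<close> differs from the model function \<open>g\<close>. An isometry taking
  the graph of \<open>c f\<close> to the graph of \<open>f\<close> takes almost all of the curve \<open>y = c g x\<close> into the graph of \<open>f\<close>,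
  hence, by continuity, an arc of that curve into the curve \<open>y = g x\<close>.

  If \<open>g\<close> is linear, the isometry maps the one line onto the other, so \<open>E\<close> is invariant under
  similarities of the real line of every ratio \<open>r > 1\<close>. If they have no common fixed point, their
  commutators generate all translations; otherwise the dilations spread every other point of \<open>E\<close>
  over a half-line. So \<open>E\<close> has at most one point, and comparing the distance of that point of the
  graph from the line excludes \<open>c \<noteq> 1\<close>.

  If \<open>g\<close> is exponential, a growth comparison forces the isometry to be the translation that carries
  \<open>c g\<close> to \<open>g\<close>, which yields \<open>f (x + s) - a = exp (k s) (f x - a)\<close> for all \<open>x\<close> and \<open>s\<close>.
\<close>

section \<open>Null sets and meagre sets as small sets\<close>

text \<open>
  The only smallness property of null sets and of meagre sets that the argument needs.
\<close>

definition slim :: "real set \<Rightarrow> bool" where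
  "slim E \<longleftrightarrow> (\<forall>u v X. u < v \<longrightarrow> X differentiable_on {u..v} \<longrightarrow> inj_on X {u..v} \<longrightarrow>
     (\<exists>t\<in>{u..v}. t \<notin> E \<and> X t \<notin> E))"

lemma slimD:
  assumes "slim E" "u < v" "X differentiable_on {u..v}" "inj_on X {u..v}"
  obtains t where "t \<in> {u..v}" "t \<notin> E" "X t \<notin> E"
  using assms(1)[unfolded slim_def, rule_format, OF assms(2-4)] by (elim bexE conjE)

lemma slim_avoids_interval:
  assumes "slim E" "u < v"
  obtains t where "t \<in> {u..v}" "t \<notin> E"
proof -
  have "(\<lambda>x. x) differentiable_on {u..v}" "inj_on (\<lambda>x. x) {u..v}"
    by auto
  then show ?thesis
    by (rule slimD[OF assms]) (rule that)
qed

lemma interior_image_interval_nonempty: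
  fixes X :: "real \<Rightarrow> real"
  assumes "u < v" "continuous_on {u..v} X" "inj_on X {u..v}"
  shows "interior (X ` {u..v}) \<noteq> {}"
proof -
  have ne: "X u \<noteq> X v"
    using assms by (auto dest: inj_onD)
  have "connected (X ` {u..v})"
    using assms(2) by (intro connected_continuous_image) auto
  then have "{min (X u) (X v)..max (X u) (X v)} \<subseteq> X ` {u..v}"
    using assms(1) by (intro connected_contains_Icc) (auto simp: min_def max_def)
  then have "interior {min (X u) (X v)..max (X u) (X v)} \<subseteq> interior (X ` {u..v})"
    by (rule interior_mono)
  moreover have "interior {min (X u) (X v)..max (X u) (X v)} \<noteq> {}"
    using ne by (auto simp: min_def max_def)
  ultimately show ?thesis
    by blast
qed

text \<open>A failure means that \<open>X\<close>
  {u..v}\<open>is covered by\<close>E\<open>and\<close>X \<open>(E \<inter> {u..v})\<close>.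
  Differentiable maps preserve null sets, so this cover is null, while the image contains an
  interval. This is why \<open>slim\<close> speaks of differentiable maps.\<close>

lemma negligible_imp_slim:
  assumes "negligible E"
  shows "slim E"
  unfolding slim_def
proof (intro allI impI, rule ccontr)
  fix u v :: real and X :: "real \<Rightarrow> real"
  assume uv: "u < v" and diff: "X differentiable_on {u..v}" and inj: "inj_on X {u..v}"
    and *: "\<not> (\<exists>t\<in>{u..v}. t \<notin> E \<and> X t \<notin> E)"
  have "negligible (X ` (E \<inter> {u..v}))"
    using assms diff
    by (intro negligible_differentiable_image_negligible)
       (auto intro: negligible_subset differentiable_on_subset)
  then have "negligible (X ` (E \<inter> {u..v}) \<union> E)"
    using assms by (simp add: negligible_Un)
  moreover have "interior (X ` {u..v}) \<subseteq> X ` (E \<inter> {u..v}) \<union> E"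
    using * interior_subset by fastforce
  ultimately have "negligible (interior (X ` {u..v}))"
    by (rule negligible_subset)
  moreover have "interior (X ` {u..v}) \<noteq> {}"
    using uv diff inj by (intro interior_image_interval_nonempty differentiable_imp_continuous_on)
  ultimately show False
    using open_not_negligible by blast
qed

text \<open>A failure covers \<open>{u..v}\<close> by countably many closed sets, the closures of
  the \<open>N n\<close> and their preimages \<open>P n\<close> under \<open>X\<close>. All have
  empty interior, contrary to Baire's theorem.\<close>

lemma meagre_imp_slim:
  assumes "meagre E"
  shows "slim E"
  unfolding slim_def
proof (intro allI impI, rule ccontr)
  fix u v :: real and X :: "real \<Rightarrow> real"
  assume uv: "u < v" and diff: "X differentiable_on {u..v}" and inj: "inj_on X {u..v}"
    and *: "\<not> (\<exists>t\<in>{u..v}. t \<notin> E \<and> X t \<notin> E)"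
  obtain N :: "nat \<Rightarrow> real set" where N: "\<And>n. interior (closure (N n)) = {}" "E = (\<Union>n. N n)"
    using assms unfolding meagre_def nowhere_dense_def by blast
  have cont: "continuous_on {u..v} X"
    using diff by (rule differentiable_imp_continuous_on)
  define P where "P n = {u..v} \<inter> X -` closure (N n)" for n
  have clP: "closed (P n)" for n
    unfolding P_def using cont by (intro continuous_closed_preimage) auto
  have intP: "interior (P n) = {}" for n
  \<comment> \<open>An interval inside \<open>P n\<close> would have an image with interior points
    inside the closure of \<open>N n\<close>.\<close>
  proof (rule ccontr)
    assume "interior (P n) \<noteq> {}"
    then obtain t e where e: "e > 0" "cball t e \<subseteq> P n"
      by (metis all_not_in_conv mem_interior_cball)
    then have I: "{t - e..t + e} \<subseteq> P n"
      by (simp add: cball_eq_atLeastAtMost)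
    then have "{t - e..t + e} \<subseteq> {u..v}"
      by (auto simp: P_def)
    then have "interior (X ` {t - e..t + e}) \<noteq> {}"
      using e cont inj
      by (intro interior_image_interval_nonempty) (auto intro: continuous_on_subset inj_on_subset)
    moreover have "X ` {t - e..t + e} \<subseteq> closure (N n)"
      using I by (auto simp: P_def)
    ultimately show False
      using N(1) interior_mono by (metis subset_empty)
  qed
  let ?G = "range (\<lambda>n. closure (N n)) \<union> range P"
  have "euclidean interior_of \<Union>?G = {}"
    by (rule Baire_category_alt)
       (use clP intP N(1) in \<open>auto simp: completely_metrizable_space_euclidean\<close>)
  then have "interior (\<Union>?G) = {}"
    by simp
  moreover have "{u..v} \<subseteq> \<Union>?G"
  proof
    fix t assume t: "t \<in> {u..v}"
    with * N(2) consider n where "t \<in> N n" | n where "X t \<in> N n"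
      by blast
    then show "t \<in> \<Union>?G"
    proof cases
      case 1
      then show ?thesis
        using closure_subset by blast
    next
      case 2
      then have "t \<in> P n"
        using t closure_subset by (auto simp: P_def)
      then show ?thesis
        by blast
    qed
  qed
  ultimately have "interior {u..v} = {}"
    by (metis interior_mono subset_empty)
  then show False
    using uv by simp
qed

lemma ae_or_comeagre_imp_slim:
  assumes "(AE x in lebesgue. f x = g x) \<or> (\<exists>C. comeagre C \<and> (\<forall>x\<in>C. f x = g x))"
  shows "slim {x. f x \<noteq> g x}"
  using assms
proof
  assume "AE x in lebesgue. f x = g x"
  then obtain N where "{x. f x \<noteq> g x} \<subseteq> N" "N \<in> null_sets lebesgue"
    by (auto simp: eventually_ae_filter)
  then show ?thesis
    by (meson negligible_iff_null_sets negligible_imp_slim negligible_subset)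
next
  assume "\<exists>C. comeagre C \<and> (\<forall>x\<in>C. f x = g x)"
  then obtain C where C: "comeagre C" "\<And>x. x \<in> C \<Longrightarrow> f x = g x"
    by blast
  then have "slim (- C)"
    by (simp add: comeagre_def meagre_imp_slim)
  \<comment> \<open>The exceptional set lies in \<open>- C\<close>, and slimness passes to
    subsets.\<close>
  then show ?thesis
    using C(2) unfolding slim_def by (metis (mono_tags, lifting) ComplI mem_Collect_eq)
qed

section \<open>Isometries in coordinates, and transfer of identities to the model curve\<close>

text \<open>After subtracting \<phi> 0 the map is orthogonal; (\<alpha>, \<alpha>') and (\<beta>,
  \<beta>') are the images of the unit vectors and hence orthonormal.\<close>

lemma plane_isometry_affine:
  assumes "plane_isometry \<phi>"
  obtains \<alpha> \<alpha>' \<beta> \<beta>' \<gamma> \<gamma>' where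
    "\<forall>x y. \<phi> (x, y) = (\<alpha> * x + \<beta> * y + \<gamma>, \<alpha>' * x + \<beta>' * y + \<gamma>')"
    "\<alpha>\<^sup>2 + \<alpha>'\<^sup>2 = 1" "\<beta>\<^sup>2 + \<beta>'\<^sup>2 = 1" "\<alpha> * \<beta> + \<alpha>' * \<beta>' = 0"
proof -
  define \<psi> where "\<psi> p = \<phi> p - \<phi> 0" for p
  have orth: "orthogonal_transformation \<psi>"
    using assms by (simp add: orthogonal_transformation_isometry \<psi>_def plane_isometry_def dist_norm)
  then have lin: "linear \<psi>" and inn: "\<And>p q. \<psi> p \<bullet> \<psi> q = p \<bullet> q"
    by (auto simp: orthogonal_transformation_def)
  obtain \<alpha> \<alpha>' \<beta> \<beta>' \<gamma> \<gamma>' where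
    ab: "\<psi> (1, 0) = (\<alpha>, \<alpha>')" "\<psi> (0, 1) = (\<beta>, \<beta>')" "\<phi> 0 = (\<gamma>, \<gamma>')"
    by (metis surj_pair)
  have "\<phi> (x, y) = (\<alpha> * x + \<beta> * y + \<gamma>, \<alpha>' * x + \<beta>' * y + \<gamma>')" for x y
  proof -
    have "(x, y) = x *\<^sub>R (1, 0) + y *\<^sub>R (0, 1 :: real)"
      by simp
    then have "\<psi> (x, y) = x *\<^sub>R \<psi> (1, 0) + y *\<^sub>R \<psi> (0, 1)"
      by (simp only: linear_add[OF lin] linear_scale[OF lin])
    moreover have "\<phi> (x, y) = \<psi> (x, y) + \<phi> 0"
      by (simp add: \<psi>_def)
    ultimately show ?thesis
      by (simp add: ab mult.commute)
  qed
  moreover have "\<alpha>\<^sup>2 + \<alpha>'\<^sup>2 = 1" "\<beta>\<^sup>2 + \<beta>'\<^sup>2 = 1" "\<alpha> * \<beta> + \<alpha>' * \<beta>' = 0"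
    using inn[of "(1, 0)" "(1, 0)"] inn[of "(0, 1)" "(0, 1)"] inn[of "(1, 0)" "(0, 1)"]
    by (simp_all add: ab power2_eq_square)
  ultimately show ?thesis
    using that by blast
qed

lemma plane_isometry_inj:
  assumes "plane_isometry \<phi>"
  shows "inj \<phi>"
proof (rule injI)
  fix p q assume "\<phi> p = \<phi> q"
  then have "dist p q = 0"
    using assms unfolding plane_isometry_def by (metis dist_self)
  then show "p = q"
    by simp
qed

text \<open>In the applications \<open>(X t, Y t)\<close> is the isometric image of a point of the
  scaled model curve. If it left the model curve, it would do so on a whole interval by continuity;
  slimness gives a parameter there at which \<open>f\<close> agrees with \<open>g\<close> both at
  \<open>s\<close> and at \<open>X s\<close>.\<close>

lemma eq_on_open_if_slim:
  fixes X Y g :: "real \<Rightarrow> real"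
  assumes slim: "slim {x. f x \<noteq> g x}" and graph: "\<And>t. f t = g t \<Longrightarrow> f (X t) = Y t"
    and diff: "\<And>t. X differentiable at t" and cont: "continuous_on UNIV Y" "continuous_on UNIV g"
    and J: "open J" "inj_on X J" and "t \<in> J"
  shows "g (X t) = Y t"
proof (rule ccontr)
  assume ne: "g (X t) \<noteq> Y t"
  have "continuous_on UNIV X"
    using diff by (simp add: continuous_at_imp_continuous_on differentiable_imp_continuous_within)
  then have "continuous_on UNIV (\<lambda>t. g (X t))"
    using cont(2) continuous_on_compose2 by blast
  then have "open {t. g (X t) \<noteq> Y t}"
    using cont(1) by (intro open_Collect_neq)
  then have "open (J \<inter> {t. g (X t) \<noteq> Y t})"
    using J by blast
  then obtain e where e: "e > 0" "cball t e \<subseteq> J \<inter> {t. g (X t) \<noteq> Y t}"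
    using ne \<open>t \<in> J\<close> by (metis (mono_tags, lifting) IntI mem_Collect_eq open_contains_cball)
  then have I: "{t - e..t + e} \<subseteq> J \<inter> {t. g (X t) \<noteq> Y t}"
    by (simp add: cball_eq_atLeastAtMost)
  have "t - e < t + e"
    using e by simp
  moreover have "X differentiable_on {t - e..t + e}"
    using diff differentiable_at_imp_differentiable_on by blast
  moreover have "inj_on X {t - e..t + e}"
    using J(2) I by (auto intro: inj_on_subset)
  ultimately obtain s where "s \<in> {t - e..t + e}" "f s = g s" "f (X s) = g (X s)"
    using slimD[OF slim] by (metis (mono_tags, lifting) mem_Collect_eq)
  then show False
    using graph I by auto
qed

text \<open>For positive \<open>B\<close> the left side grows doubly exponentially and outruns the
  right side. For negative \<open>B\<close> it tends to 0, which forces \<open>P\<close> and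
  \<open>Q\<close> to vanish.\<close>

lemma no_affine_exp_identity:
  fixes \<alpha> B D P Q R b :: real
  assumes "B \<noteq> 0" "b \<noteq> 0" "P \<noteq> 0 \<or> Q \<noteq> 0"
    and ev: "\<forall>\<^sub>F u in at_top. b * exp (\<alpha> * u + B * exp u + D) = P * u + Q * exp u + R"
  shows False
proof (cases "B > 0")
  case True
  have top: "filterlim (\<lambda>u. exp (\<alpha> * u + B * exp u + D) / exp (2 * u)) at_top at_top"
    using True by real_asymp
  have "((\<lambda>u. (P * u + Q * exp u + R) / b / exp (2 * u)) \<longlongrightarrow> 0) at_top"
  proof -
    have "((\<lambda>u :: real. u / exp (2 * u)) \<longlongrightarrow> 0) at_top" "((\<lambda>u :: real. exp u / exp (2 * u)) \<longlongrightarrow> 0) at_top"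
      "((\<lambda>u :: real. 1 / exp (2 * u)) \<longlongrightarrow> 0) at_top"
      by real_asymp+
    then have "((\<lambda>u. P / b * (u / exp (2 * u)) + Q / b * (exp u / exp (2 * u)) + R / b * (1 / exp (2 * u)))
        \<longlongrightarrow> P / b * 0 + Q / b * 0 + R / b * 0) at_top"
      by (intro tendsto_intros)
    then show ?thesis
      by (simp add: add_divide_distrib)
  qed
  moreover have "\<forall>\<^sub>F u in at_top. exp (\<alpha> * u + B * exp u + D) / exp (2 * u)
      = (P * u + Q * exp u + R) / b / exp (2 * u)"
    using ev by eventually_elim (use \<open>b \<noteq> 0\<close> in \<open>simp add: field_simps\<close>)
  ultimately have "filterlim (\<lambda>u. exp (\<alpha> * u + B * exp u + D) / exp (2 * u)) (nhds 0) at_top"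
    by (simp add: filterlim_cong)
  with top show False
    by (meson filterlim_at_top_imp_at_infinity not_tendsto_and_filterlim_at_infinity
        trivial_limit_at_top_linorder)
next
  case False
  then have "B < 0"
    using \<open>B \<noteq> 0\<close> by simp
  \<comment> \<open>Division by \<open>exp u\<close> isolates \<open>Q\<close>; once
    \<open>Q\<close> is known to be 0, division by \<open>u\<close> isolates
    \<open>P\<close>.\<close>
  have limQ: "((\<lambda>u. b * exp (\<alpha> * u + B * exp u + D) / exp u) \<longlongrightarrow> 0) at_top"
    and limP: "((\<lambda>u. b * exp (\<alpha> * u + B * exp u + D) / u) \<longlongrightarrow> 0) at_top"
    using \<open>B < 0\<close> by real_asymp+
  have "((\<lambda>u. (P * u + Q * exp u + R) / exp u) \<longlongrightarrow> 0) at_top"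
    by (rule Lim_transform_eventually[OF limQ]) (use ev in eventually_elim, simp)
  moreover have "((\<lambda>u. (P * u + Q * exp u + R) / exp u) \<longlongrightarrow> Q) at_top"
    by real_asymp
  ultimately have "Q = 0"
    using tendsto_unique[OF trivial_limit_at_top_linorder] by blast
  have "((\<lambda>u. (P * u + R) / u) \<longlongrightarrow> 0) at_top"
    by (rule Lim_transform_eventually[OF limP]) (use ev in eventually_elim, simp add: \<open>Q = 0\<close>)
  moreover have "((\<lambda>u. (P * u + R) / u) \<longlongrightarrow> P) at_top"
    by real_asymp
  ultimately have "P = 0"
    using tendsto_unique[OF trivial_limit_at_top_linorder] by blast
  with \<open>Q = 0\<close> show False
    using assms(3) by blast
qed

text \<open>The last two clauses are the two directions of "a point is on the graph of
  \<open>c * f\<close> iff its image is on the graph of \<open>f\<close>"; the backward one rests on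
  injectivity of the isometry.\<close>

lemma vertically_rigid_isometry:
  assumes "vertically_rigid f" "c > 0"
  obtains \<alpha> \<alpha>' \<beta> \<beta>' \<gamma> \<gamma>' where
    "\<alpha>\<^sup>2 + \<alpha>'\<^sup>2 = 1" "\<beta>\<^sup>2 + \<beta>'\<^sup>2 = 1" "\<alpha> * \<beta> + \<alpha>' * \<beta>' = 0"
    "\<forall>x. f (\<alpha> * x + \<beta> * (c * f x) + \<gamma>) = \<alpha>' * x + \<beta>' * (c * f x) + \<gamma>'"
    "\<forall>x y. f (\<alpha> * x + \<beta> * y + \<gamma>) = \<alpha>' * x + \<beta>' * y + \<gamma>' \<longrightarrow> y = c * f x"
proof -
  obtain \<phi> where iso: "plane_isometry \<phi>" and im: "\<phi> ` graph_of (\<lambda>x. c * f x) = graph_of f"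
    using assms unfolding vertically_rigid_def by blast
  obtain \<alpha> \<alpha>' \<beta> \<beta>' \<gamma> \<gamma>' where
    \<phi> [rule_format]: "\<forall>x y. \<phi> (x, y) = (\<alpha> * x + \<beta> * y + \<gamma>, \<alpha>' * x + \<beta>' * y + \<gamma>')"
    and orth: "\<alpha>\<^sup>2 + \<alpha>'\<^sup>2 = 1" "\<beta>\<^sup>2 + \<beta>'\<^sup>2 = 1" "\<alpha> * \<beta> + \<alpha>' * \<beta>' = 0"
    by (rule plane_isometry_affine[OF iso])
  have graph: "(x, y) \<in> graph_of h \<longleftrightarrow> y = h x" for x y h
    by (auto simp: graph_of_def)
  have "\<phi> (x, y) \<in> graph_of f \<longleftrightarrow> y = c * f x" for x y
    using inj_image_mem_iff[OF plane_isometry_inj[OF iso], of "(x, y)" "graph_of (\<lambda>x. c * f x)"]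
    by (simp add: im graph)
  then have *: "\<alpha>' * x + \<beta>' * y + \<gamma>' = f (\<alpha> * x + \<beta> * y + \<gamma>) \<longleftrightarrow> y = c * f x" for x y
    by (simp add: \<phi> graph)
  show ?thesis
  proof (rule that[OF orth]; intro allI impI)
    show "f (\<alpha> * x + \<beta> * (c * f x) + \<gamma>) = \<alpha>' * x + \<beta>' * (c * f x) + \<gamma>'" for x
      using *[of x "c * f x"] by simp
    show "y = c * f x" if "f (\<alpha> * x + \<beta> * y + \<gamma>) = \<alpha>' * x + \<beta>' * y + \<gamma>'" for x y
      using *[of x y] that by simp
  qed
qed

section \<open>The linear case\<close>

lemma slim_similarity_invariant:
  assumes slim: "slim E"
    and inv: "\<And>r. r > 1 \<Longrightarrow> \<exists>s. \<forall>t. t \<in> E \<longleftrightarrow> r * t + s \<in> E"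
  shows "E = {} \<or> (\<exists>z. E = {z})"
proof (cases "E = {}")
  case False
  then obtain x0 where x0: "x0 \<in> E"
    by blast
  obtain s where s: "\<And>r t. r > 1 \<Longrightarrow> t \<in> E \<longleftrightarrow> r * t + s r \<in> E"
    using inv by metis
  \<comment> \<open>A nonzero commutator of two of the similarities is a translation; its conjugates
    and their quotients are all the translations.\<close>
  have commute: "(r - 1) * s 2 = s r" if r: "r > 1" for r
  proof (rule ccontr)
    assume ne: "(r - 1) * s 2 \<noteq> s r"
    define \<tau> where "\<tau> = (r - 1) * s 2 - s r"
    have \<tau>: "u \<in> E \<longleftrightarrow> u + \<tau> \<in> E" for u
    proof -
      \<comment> \<open>\<open>t\<close> is the point that the composition "ratio \<open>r\<close>,
        then ratio 2" sends to \<open>u\<close>; the composition in the other order sends it to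
        \<open>u + \<tau>\<close>.\<close>
      define t where "t = ((u - s 2) / 2 - s r) / r"
      have u: "u = 2 * (r * t + s r) + s 2"
        using r by (simp add: t_def field_simps)
      have "u + \<tau> = r * (2 * t + s 2) + s r"
        by (simp add: u \<tau>_def algebra_simps)
      then show ?thesis
        using s[of r] s[of 2] r u by (metis one_less_numeral_iff semiring_norm(76))
    qed
    \<comment> \<open>Conjugating the translation by \<tau> with the similarity of ratio
      \<open>q\<close> gives the translation by \<open>q * \<tau>\<close>.\<close>
    have scaled: "y \<in> E \<longleftrightarrow> y + q * \<tau> \<in> E" if q: "q > 1" for y q
    proof -
      define t where "t = (y - s q) / q"
      have y: "y = q * t + s q"
        using q by (simp add: t_def)
      have "y + q * \<tau> = q * (t + \<tau>) + s q"
        by (simp add: y algebra_simps)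
      then show ?thesis
        using s[OF q] \<tau> y by metis
    qed
    have "y \<in> E" for y
    proof -
      define w where "w = (y - x0) / \<tau>"
      have y: "y = x0 + w * \<tau>"
        using ne by (simp add: w_def \<tau>_def)
      \<comment> \<open>Only factors above 1 are available, so the shift by
        \<open>w * \<tau>\<close> is made as a shift by \<open>(q + w) * \<tau>\<close> and one back
        by \<open>q * \<tau>\<close>; this \<open>q\<close> puts both factors above 1.\<close>
      define q where "q = 2 + \<bar>w\<bar>"
      have "y + q * \<tau> = x0 + (q + w) * \<tau>"
        by (simp add: y algebra_simps)
      moreover have "q > 1" "q + w > 1"
        by (auto simp: q_def)
      ultimately show ?thesis
        using scaled x0 by metis
    qed
    then show False
      using slim_avoids_interval[OF slim, of 0 1] by auto
  qed
  \<comment> \<open>The fixed point of the ratio 2 map; by \<open>commute\<close> it is fixed by all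
    the chosen maps.\<close>
  define z where "z = - s 2"
  have dil: "x \<in> E \<longleftrightarrow> z + r * (x - z) \<in> E" if "r > 1" for r x
  proof -
    have "z + r * (x - z) = r * x + s r"
      using commute[OF that] by (simp add: z_def algebra_simps)
    then show ?thesis
      using s[OF that] by simp
  qed
  have "x = z" if x: "x \<in> E" for x
  proof (rule ccontr)
    assume ne: "x \<noteq> z"
    \<comment> \<open>The dilations of ratio between 2 and 3 spread \<open>x\<close> over the
      interval from \<open>u\<close> to \<open>v\<close>, whose ends are ordered by
      \<open>min\<close> and \<open>max\<close>.\<close>
    define u where "u = min (z + 2 * (x - z)) (z + 3 * (x - z))"
    define v where "v = max (z + 2 * (x - z)) (z + 3 * (x - z))"
    have "u < v"
      using ne by (auto simp: u_def v_def)
    then obtain t where t: "t \<in> {u..v}" "t \<notin> E"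
      using slim_avoids_interval[OF slim] by blast
    define r where "r = (t - z) / (x - z)"
    have "r > 1"
      using t(1) ne by (auto simp: u_def v_def r_def min_def max_def field_simps split: if_splits)
    moreover have "t = z + r * (x - z)"
      using ne by (simp add: r_def)
    ultimately show False
      using dil x t(2) by metis
  qed
  then show ?thesis
    using x0 by blast
qed simp

text \<open>The isometry maps the line of slope \<open>c * b\<close> onto that of slope
  \<open>b\<close>; \<open>p * t + q\<close> is this map read on abscissas. The equation for
  \<open>p\<close> compares lengths along the two lines.\<close>

lemma rigid_linear_similarity:
  assumes rigid: "vertically_rigid f" and slim: "slim {x. f x \<noteq> a + b * x}" and c: "c > 0"
  obtains p q where "p\<^sup>2 * (1 + b\<^sup>2) = 1 + (c * b)\<^sup>2"
    "\<forall>t. f t = a + b * t \<longleftrightarrow> f (p * t + q) = a + b * (p * t + q)"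
    "\<forall>z. {x. f x \<noteq> a + b * x} = {z} \<longrightarrow> c = 1"
proof -
  obtain \<alpha> \<alpha>' \<beta> \<beta>' \<gamma> \<gamma>' where
    orth: "\<alpha>\<^sup>2 + \<alpha>'\<^sup>2 = 1" "\<beta>\<^sup>2 + \<beta>'\<^sup>2 = 1" "\<alpha> * \<beta> + \<alpha>' * \<beta>' = 0"
    and graph [rule_format]: "\<forall>x. f (\<alpha> * x + \<beta> * (c * f x) + \<gamma>) = \<alpha>' * x + \<beta>' * (c * f x) + \<gamma>'"
    and graph_imp [rule_format]: "\<forall>x y. f (\<alpha> * x + \<beta> * y + \<gamma>) = \<alpha>' * x + \<beta>' * y + \<gamma>' \<longrightarrow> y = c * f x"
    by (rule vertically_rigid_isometry[OF rigid c])
  define p q p' q' where "p = \<alpha> + \<beta> * c * b" and "q = \<beta> * c * a + \<gamma>"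
    and "p' = \<alpha>' + \<beta>' * c * b" and "q' = \<beta>' * c * a + \<gamma>'"
  have X: "\<alpha> * t + \<beta> * (c * (a + b * t)) + \<gamma> = p * t + q"
    and Y: "\<alpha>' * t + \<beta>' * (c * (a + b * t)) + \<gamma>' = p' * t + q'" for t
    by (simp_all add: p_def q_def p'_def q'_def algebra_simps)
  have "p\<^sup>2 + p'\<^sup>2 = (\<alpha>\<^sup>2 + \<alpha>'\<^sup>2) + 2 * (c * b) * (\<alpha> * \<beta> + \<alpha>' * \<beta>') + (\<beta>\<^sup>2 + \<beta>'\<^sup>2) * (c * b)\<^sup>2"
    by (simp add: p_def p'_def power2_eq_square algebra_simps)
  then have pp': "p\<^sup>2 + p'\<^sup>2 = 1 + (c * b)\<^sup>2"
    using orth by simp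
  have on_line: "f (p * t + q) = p' * t + q'" if "f t = a + b * t" for t
    using graph[of t] X[of t] Y[of t] that by simp
  \<comment> \<open>Otherwise the image line would be vertical, yet it meets the graph of
    \<open>f\<close> at two parameters, which gives a single value of
    \<open>p' * t + q'\<close>.\<close>
  have "p \<noteq> 0"
  proof
    assume "p = 0"
    obtain t1 where t1: "t1 \<in> {0..1}" "t1 \<notin> {x. f x \<noteq> a + b * x}"
      by (rule slim_avoids_interval[OF slim zero_less_one])
    obtain t2 where t2: "t2 \<in> {2..3}" "t2 \<notin> {x. f x \<noteq> a + b * x}"
      by (rule slim_avoids_interval[OF slim, of 2 3]) simp
    have "p' * t1 = p' * t2"
      using on_line[of t1] on_line[of t2] t1(2) t2(2) \<open>p = 0\<close> by auto
    moreover have "t1 \<noteq> t2"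
      using t1(1) t2(1) by auto
    ultimately have "p' = 0"
      by simp
    then have "1 + (c * b)\<^sup>2 = 0"
      using pp' \<open>p = 0\<close> by simp
    then show False
      by (smt (verit) zero_le_power2)
  qed
  have line: "a + b * (p * t + q) = p' * t + q'" for t
    by (rule eq_on_open_if_slim[OF slim, of "\<lambda>t. p * t + q" "\<lambda>t. p' * t + q'" UNIV])
       (use on_line \<open>p \<noteq> 0\<close> in \<open>auto intro!: continuous_intros derivative_intros inj_onI\<close>)
  have "p' = b * p"
    using line[of 0] line[of 1] by (simp add: algebra_simps)
  then have norm: "p\<^sup>2 * (1 + b\<^sup>2) = 1 + (c * b)\<^sup>2"
    using pp' by (simp add: power2_eq_square algebra_simps)
  have iff: "f t = a + b * t \<longleftrightarrow> f (p * t + q) = a + b * (p * t + q)" for t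
  proof
    assume "f (p * t + q) = a + b * (p * t + q)"
    then have "c * (a + b * t) = c * f t"
      using X[of t] Y[of t] line[of t] by (intro graph_imp) simp
    then show "f t = a + b * t"
      using c by simp
  qed (use on_line line in simp)
  have single: "c = 1" if E: "{x. f x \<noteq> a + b * x} = {z}" for z
  proof -
    have E_iff: "f x \<noteq> a + b * x \<longleftrightarrow> x = z" for x
      using E by blast
    \<comment> \<open>The similarity preserves the exceptional set, so it fixes its only
      point.\<close>
    have pz: "p * z + q = z"
      using E_iff iff by metis
    define h where "h = f z - (a + b * z)"
    have "h \<noteq> 0"
      using E_iff[of z] by (simp add: h_def)
    \<comment> \<open>The abscissa of the image of the one point of the scaled graph that is off its
      line.\<close>
    define w where "w = \<alpha> * z + \<beta> * (c * f z) + \<gamma>"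
    have w: "w = z + \<beta> * (c * h)"
      using X[of z] pz by (simp add: w_def h_def algebra_simps)
    have "p' * z + q' = a + b * z"
      using line[of z] pz by simp
    then have fw: "f w = a + b * z + \<beta>' * (c * h)"
      using graph[of z] Y[of z] by (simp add: w_def h_def algebra_simps)
    \<comment> \<open>Otherwise that image lies on the line of slope \<open>b\<close>. Then
      (\<beta>, \<beta>') is parallel to \<open>(1, b)\<close>, and so is (\<alpha>, \<alpha>'),
      although the two are orthonormal.\<close>
    have "w = z"
    proof (rule ccontr)
      assume "w \<noteq> z"
      then have "f w = a + b * w"
        using E_iff by blast
      then have "(\<beta>' - b * \<beta>) * (c * h) = 0"
        unfolding fw unfolding w by (simp add: algebra_simps)
      then have "\<beta>' = b * \<beta>"
        using \<open>h \<noteq> 0\<close> c by simp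
      moreover have "\<alpha>' = b * \<alpha>"
        using \<open>p' = b * p\<close> \<open>\<beta>' = b * \<beta>\<close> by (simp add: p_def p'_def algebra_simps)
      ultimately have "\<alpha>\<^sup>2 * (1 + b\<^sup>2) = 1" "\<beta>\<^sup>2 * (1 + b\<^sup>2) = 1" "\<alpha> * \<beta> * (1 + b\<^sup>2) = 0"
        using orth by (simp_all add: power2_eq_square algebra_simps)
      then show False
        by auto
    qed
    then have "\<beta> = 0"
      using w \<open>h \<noteq> 0\<close> c by simp
    \<comment> \<open>The vertical offset \<open>c * h\<close> is carried to the offset
      \<open>h\<close>, while \<beta>' can now only be a sign.\<close>
    have "\<beta>' * (c * h) = h"
      using fw unfolding \<open>w = z\<close> h_def by linarith
    then have "(\<beta>' * c - 1) * h = 0"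
      by (simp add: algebra_simps)
    then have "\<beta>' * c = 1"
      using \<open>h \<noteq> 0\<close> by simp
    moreover have "\<beta>'\<^sup>2 = 1"
      using orth(2) \<open>\<beta> = 0\<close> by simp
    ultimately show "c = 1"
      using c by (auto simp: power2_eq_1_iff)
  qed
  show ?thesis
    using that[of p q] norm iff single by blast
qed

lemma rigid_linear:
  assumes rigid: "vertically_rigid f" and b: "b \<noteq> 0" and slim: "slim {x. f x \<noteq> a + b * x}"
  shows "f x = a + b * x"
proof -
  let ?E = "{x. f x \<noteq> a + b * x}"
  have "\<exists>s. \<forall>t. t \<in> ?E \<longleftrightarrow> r * t + s \<in> ?E" if r: "r > 1" for r
  proof -
    \<comment> \<open>This \<open>c\<close> makes \<open>p\<^sup>2 = r\<close>. The sign of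
      \<open>p\<close> is unknown, so the similarity is applied twice to obtain the positive ratio
      \<open>r\<close>.\<close>
    define c where "c = sqrt (r * (1 + b\<^sup>2) - 1) / \<bar>b\<bar>"
    have "1 * 1 < r * (1 + b\<^sup>2)"
      using r b by (intro mult_strict_mono) auto
    then have c: "c > 0" "(c * b)\<^sup>2 = r * (1 + b\<^sup>2) - 1"
      using b by (simp_all add: c_def power_mult_distrib power_divide)
    obtain p q where pq: "p\<^sup>2 * (1 + b\<^sup>2) = 1 + (c * b)\<^sup>2"
      and iff [rule_format]: "\<forall>t. f t = a + b * t \<longleftrightarrow> f (p * t + q) = a + b * (p * t + q)"
      and "\<forall>z. ?E = {z} \<longrightarrow> c = 1"
      by (rule rigid_linear_similarity[OF rigid slim c(1)])
    from pq have "p\<^sup>2 * (1 + b\<^sup>2) = r * (1 + b\<^sup>2)"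
      using c(2) by simp
    moreover have "1 + b\<^sup>2 \<noteq> 0"
      by (smt (verit) zero_le_power2)
    ultimately have "r = p\<^sup>2"
      by simp
    then have "r * t + (p * q + q) = p * (p * t + q) + q" for t
      by (simp add: power2_eq_square algebra_simps)
    then have "\<forall>t. t \<in> ?E \<longleftrightarrow> r * t + (p * q + q) \<in> ?E"
      using iff by (metis (mono_tags, lifting) mem_Collect_eq)
    then show ?thesis ..
  qed
  from slim_similarity_invariant[OF slim this] consider "?E = {}" | z where "?E = {z}"
    by blast
  then show ?thesis
  proof cases
    case 2
    have "(2 :: real) > 0"
      by simp
    then have "(2 :: real) = 1"
      by (rule rigid_linear_similarity[OF rigid slim]) (use 2 in blast)
    then show ?thesis
      by simp
  qed blast
qed

section \<open>The exponential case\<close>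

text \<open>On this set the exponential term dominates the derivative. By Rolle's argument, equal
  values would make the derivative vanish at an intermediate \<open>z\<close>, where the exponential
  is at least the smaller of its two end values.\<close>

lemma inj_on_linear_plus_exp:
  fixes \<alpha> K k :: real
  assumes "k \<noteq> 0"
  shows "inj_on (\<lambda>t. \<alpha> * t + K * exp (k * t) + D) {t. \<bar>\<alpha>\<bar> < \<bar>K * k\<bar> * exp (k * t)}" (is "inj_on ?X ?J")
proof (rule linorder_inj_onI')
  fix t1 t2 assume t: "t1 \<in> ?J" "t2 \<in> ?J" "t1 < t2"
  show "?X t1 \<noteq> ?X t2"
  proof
    assume eq: "?X t1 = ?X t2"
    have "\<exists>z>t1. z < t2 \<and> ?X t2 - ?X t1 = (t2 - t1) * (\<alpha> + K * (k * exp (k * z)))"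
      using t(3) by (intro MVT2) (auto intro!: derivative_eq_intros)
    then obtain z where z: "t1 < z" "z < t2" "\<alpha> + K * (k * exp (k * z)) = 0"
      using eq t(3) by auto
    then have "\<alpha> = - (K * k * exp (k * z))"
      by (simp add: algebra_simps)
    then have "\<bar>\<alpha>\<bar> = \<bar>K * k\<bar> * exp (k * z)"
      by (simp add: abs_mult)
    moreover have "min (k * t1) (k * t2) \<le> k * z"
      using z by (cases "k > 0") (auto simp: min_le_iff_disj mult_le_cancel_left)
    then have "exp (k * t1) \<le> exp (k * z) \<or> exp (k * t2) \<le> exp (k * z)"
      by (auto simp: min_le_iff_disj)
    then have "\<bar>K * k\<bar> * exp (k * t1) \<le> \<bar>K * k\<bar> * exp (k * z) \<or>
        \<bar>K * k\<bar> * exp (k * t2) \<le> \<bar>K * k\<bar> * exp (k * z)"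
      by (meson abs_ge_zero mult_left_mono)
    ultimately show False
      using t(1,2) by auto
  qed
qed

lemma rigid_exp_functional_equation:
  fixes a b k :: real
  assumes rigid: "vertically_rigid f" and b: "b \<noteq> 0" and k: "k \<noteq> 0"
    and slim: "slim {x. f x \<noteq> a + b * exp (k * x)}"
  shows "f (x + s) - a = exp (k * s) * (f x - a)"
proof -
  \<comment> \<open>Scaling \<open>b * exp (k * x)\<close> by this factor is the same as shifting
    its argument by \<open>s\<close>.\<close>
  define c where "c = exp (k * s)"
  have c: "c > 0"
    by (simp add: c_def)
  obtain \<alpha> \<alpha>' \<beta> \<beta>' \<gamma> \<gamma>' where
    orth: "\<alpha>\<^sup>2 + \<alpha>'\<^sup>2 = 1" "\<beta>\<^sup>2 + \<beta>'\<^sup>2 = 1" "\<alpha> * \<beta> + \<alpha>' * \<beta>' = 0"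
    and graph [rule_format]: "\<forall>x. f (\<alpha> * x + \<beta> * (c * f x) + \<gamma>) = \<alpha>' * x + \<beta>' * (c * f x) + \<gamma>'"
    and "\<forall>x y. f (\<alpha> * x + \<beta> * y + \<gamma>) = \<alpha>' * x + \<beta>' * y + \<gamma>' \<longrightarrow> y = c * f x"
    by (rule vertically_rigid_isometry[OF rigid c])
  define K D K' D' where "K = \<beta> * c * b" and "D = \<beta> * c * a + \<gamma>"
    and "K' = \<beta>' * c * b" and "D' = \<beta>' * c * a + \<gamma>'"
  define X where "X t = \<alpha> * t + K * exp (k * t) + D" for t
  define Y where "Y t = \<alpha>' * t + K' * exp (k * t) + D'" for t
  have "f (X t) = Y t" if "f t = a + b * exp (k * t)" for t
    using graph[of t] that by (simp add: X_def Y_def K_def D_def K'_def D'_def algebra_simps)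
  moreover have "(X has_real_derivative \<alpha> + K * (k * exp (k * t))) (at t)" for t
    unfolding X_def[abs_def] by (auto intro!: derivative_eq_intros)
  then have "X differentiable at t" for t
    by (meson real_differentiable_def)
  moreover have "continuous_on UNIV Y" "continuous_on UNIV (\<lambda>x. a + b * exp (k * x))"
    unfolding Y_def[abs_def] by (intro continuous_intros)+
  ultimately have curve: "a + b * exp (k * X t) = Y t" if "open J" "inj_on X J" "t \<in> J" for t J
    using eq_on_open_if_slim[OF slim, of X Y J] that by blast
  \<comment> \<open>If not, \<open>X\<close> contains an exponential and
    \<open>exp (k * X t)\<close> a double one. With \<open>u = k * t\<close> the identity of the
    curves becomes the one excluded by \<open>no_affine_exp_identity\<close>.\<close>
  have "\<beta> = 0"
  proof (rule ccontr)
    assume \<beta>: "\<beta> \<noteq> 0"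
    define J where "J = {t. \<bar>\<alpha>\<bar> < \<bar>K * k\<bar> * exp (k * t)}"
    have J: "open J" "inj_on X J"
      using inj_on_linear_plus_exp[OF k] unfolding J_def X_def[abs_def]
      by (auto intro!: open_Collect_less continuous_intros)
    have "K * k \<noteq> 0"
      using b k c \<beta> by (simp add: K_def)
    then have "filterlim (\<lambda>u. \<bar>K * k\<bar> * exp u) at_top at_top"
      by (intro filterlim_tendsto_pos_mult_at_top[OF tendsto_const] exp_at_top) simp
    then have "\<forall>\<^sub>F u in at_top. \<bar>\<alpha>\<bar> < \<bar>K * k\<bar> * exp u"
      by (simp add: filterlim_at_top_dense)
    then have "\<forall>\<^sub>F u in at_top. b * exp (\<alpha> * u + (k * K) * exp u + k * D)
        = \<alpha>' / k * u + K' * exp u + (D' - a)"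
    proof eventually_elim
      case (elim u)
      then have "u / k \<in> J"
        using k by (simp add: J_def)
      from curve[OF J this] show ?case
        using k by (simp add: X_def Y_def algebra_simps)
    qed
    moreover have "\<alpha>' / k \<noteq> 0 \<or> K' \<noteq> 0"
    proof (rule ccontr)
      assume "\<not> ?thesis"
      then have "\<alpha>' = 0" "\<beta>' = 0"
        using b c k by (simp_all add: K'_def)
      then show False
        using orth \<beta> by auto
    qed
    moreover have "k * K \<noteq> 0"
      using \<open>K * k \<noteq> 0\<close> by simp
    ultimately show False
      using no_affine_exp_identity[OF _ b] by blast
  qed
  then have \<beta>': "\<beta>' = 1 \<or> \<beta>' = - 1" and "\<alpha>' = 0"
    using orth by (auto simp: power2_eq_1_iff)
  then have \<alpha>: "\<alpha> = 1 \<or> \<alpha> = - 1"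
    using orth by (auto simp: power2_eq_1_iff)
  have KD: "K = 0" "D = \<gamma>"
    using \<open>\<beta> = 0\<close> by (simp_all add: K_def D_def)
  have X: "X = (\<lambda>t. \<alpha> * t + \<gamma>)"
    by (simp add: X_def fun_eq_iff KD)
  have "inj X"
    using \<alpha> by (auto simp: X intro!: injI)
  then have eq: "a + b * exp (k * (\<alpha> * t + \<gamma>)) = K' * exp (k * t) + D'" for t
    using curve[of UNIV t] by (simp add: X Y_def \<open>\<alpha>' = 0\<close>)
  define A where "A = b * exp (k * \<gamma>)"
  have "A \<noteq> 0"
    using b by (simp add: A_def)
  \<comment> \<open>The values \<open>u = 0\<close>, \<open>ln 2\<close> and \<open>- ln 2\<close>
    give linear equations in \<open>A\<close>, \<open>K'\<close> and \<open>D' - a\<close>; for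
    \<alpha> = -1 they force \<open>A = 0\<close>.\<close>
  have eqA: "A * exp (\<alpha> * u) = K' * exp u + (D' - a)" for u
    using eq[of "u / k"] k by (simp add: A_def algebra_simps exp_add)
  have "\<alpha> = 1"
  proof (rule ccontr)
    assume "\<alpha> \<noteq> 1"
    then have "\<alpha> = - 1"
      using \<alpha> by blast
    then have "A = K' + (D' - a)" "A / 2 = K' * 2 + (D' - a)" "A * 2 = K' / 2 + (D' - a)"
      using eqA[of 0] eqA[of "ln 2"] eqA[of "- ln 2"] by (simp_all add: exp_minus field_simps)
    then show False
      using \<open>A \<noteq> 0\<close> by argo
  qed
  then have "A = K' + (D' - a)" "A * 2 = K' * 2 + (D' - a)"
    using eqA[of 0] eqA[of "ln 2"] by simp_all
  then have "D' = a" "A = K'"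
    by argo+
  then have "exp (k * \<gamma>) = \<beta>' * c"
    using b by (simp add: A_def K'_def)
  moreover have "\<beta>' \<noteq> - 1"
  proof
    assume "\<beta>' = - 1"
    then have "exp (k * \<gamma>) = - c"
      using \<open>exp (k * \<gamma>) = \<beta>' * c\<close> by simp
    then show False
      using c exp_gt_zero[of "k * \<gamma>"] by linarith
  qed
  then have "\<beta>' = 1"
    using \<beta>' by blast
  ultimately have "\<gamma> = s"
    using k by (simp add: c_def)
  \<comment> \<open>The graph relation holds at every \<open>x\<close>, exceptional or not, so the
    resulting equation does too.\<close>
  have "f (x + s) = c * f x + \<gamma>'"
    using graph[of x] by (simp add: \<open>\<alpha> = 1\<close> \<open>\<beta> = 0\<close> \<open>\<beta>' = 1\<close> \<open>\<alpha>' = 0\<close> \<open>\<gamma> = s\<close>)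
  moreover have "\<gamma>' = a - c * a"
    using \<open>D' = a\<close> \<open>\<beta>' = 1\<close> by (simp add: D'_def)
  ultimately show ?thesis
    by (simp add: c_def algebra_simps)
qed

text \<open>The functional equation holds everywhere, so agreement at a single point
  \<open>t\<close> propagates to the whole line.\<close>

lemma rigid_exp:
  assumes "vertically_rigid f" "b \<noteq> 0" "k \<noteq> 0" and slim: "slim {x. f x \<noteq> a + b * exp (k * x)}"
  shows "f x = a + b * exp (k * x)"
proof -
  obtain t where "f t = a + b * exp (k * t)"
    using slim_avoids_interval[OF slim, of 0 1] by auto
  then have "f x - a = exp (k * (x - t)) * (b * exp (k * t))"
    using rigid_exp_functional_equation[OF assms, of t "x - t"] by simp
  also have "\<dots> = b * exp (k * x)"
    by (simp add: algebra_simps flip: exp_add)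
  finally show ?thesis
    by simp
qed

theorem theorem4p2:
  fixes f :: "real \<Rightarrow> real"
  assumes "vertically_rigid f"
  shows "(\<forall>a b :: real. b \<noteq> 0 \<longrightarrow>
            ((AE x in lebesgue. f x = a + b * x) \<or>
             (\<exists>C :: real set. comeagre C \<and> (\<forall>x\<in>C. f x = a + b * x))) \<longrightarrow>
            (\<forall>x. f x = a + b * x)) \<and>
         (\<forall>a b k :: real. b * k \<noteq> 0 \<longrightarrow>
            ((AE x in lebesgue. f x = a + b * exp (k * x)) \<or>
             (\<exists>C :: real set. comeagre C \<and> (\<forall>x\<in>C. f x = a + b * exp (k * x)))) \<longrightarrow>
            (\<forall>x. f x = a + b * exp (k * x)))"
proof (intro conjI allI impI)
  fix a b x :: real
  assume "b \<noteq> 0" "(AE x in lebesgue. f x = a + b * x) \<or>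
    (\<exists>C :: real set. comeagre C \<and> (\<forall>x\<in>C. f x = a + b * x))"
  then show "f x = a + b * x"
    by (intro rigid_linear[OF assms] ae_or_comeagre_imp_slim)
next
  fix a b k x :: real
  assume "b * k \<noteq> 0" "(AE x in lebesgue. f x = a + b * exp (k * x)) \<or>
    (\<exists>C :: real set. comeagre C \<and> (\<forall>x\<in>C. f x = a + b * exp (k * x)))"
  then show "f x = a + b * exp (k * x)"
    by (intro rigid_exp[OF assms] ae_or_comeagre_imp_slim) auto
qed

end
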